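(* Let $\mathbb{D}$ be the unit disk or the complex plane, $y:\mathbb{D}\to S^{n+2}$ a Willmore surface and $z_0\in\mathbb{D}$ a base point. Let $(\mu,S)$ be an orientation reversing symmetry of the harmonic conformal Gauss map $f:\mathbb{D}\to SO^+(1,n+3)/(SO^+(1,3)\times SO(n))$ of $y$. Let $F(z,\bar z,\lambda)$ be the extended frame of $f$ with $F(z_0,\bar z_0,\lambda)=I$, let $M(\lambda)\in\Lambda O^+(1,n+3)_\sigma$ and $k(z,\bar z)\in O^+(1,3)\times O(n)$ be such that $F(\mu(z),\overline{\mu(z)},\lambda)=M(\lambda)F(z,\bar z,\lambda^{-1})k(z,\bar z)$, and let $F(z,\bar z,\lambda)=F_-(z,\lambda)F_+(z,\bar z,\lambda)$ be the Birkhoff decomposition. Then (wherever both sides are defined) $$F_-(\mu(z),\lambda)=M(\lambda)\,\overline{F_-(z,\lambda^{-1})}\cdot W_+(\bar z,\lambda),$$ where $$W_+(\bar z,\lambda)=\overline{F_+(z,\bar z,\lambda^{-1})}\cdot k(z,\bar z)\cdot\big(F_+(\mu(z),\overline{\mu(z)},\lambda)\big)^{-1}.$$ For the normalized potential $\eta=F_-^{-1}dF_-$ of $f$ one obtains $$\mu^*\eta(z,\lambda)=\overline{\eta(z,\lambda^{-1})}\,\sharp\,W_+ .$$ Moreover: (1) if $\det\hat S=1$, then $W_+$ takes values in $\Lambda^+SO^+(1,n+3,\mathbb{C})_\sigma$; (2) if $\det\hat S=-1$, then $P_2W_+$ takes values in $\Lambda^+SO^+(1,n+3,\mathbb{C}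)_\sigma$.
   Context: $\mathbb{R}^{n+4}_1$ is $\mathbb{R}^{n+4}$ with $\langle x,y\rangle=x^tI_{1,n+3}y$, $I_{1,n+3}=\mathrm{diag}(-1,1,\dots,1)$; $S^{n+2}$ is identified with the projectivized forward light cone by $x\mapsto[(1,x)]$. $O^+(1,n+3)$: $I_{1,n+3}$-orthogonal real matrices preserving the forward light cone (every conformal diffeomorphism $S$ of $S^{n+2}$ is induced by a unique $\hat S\in O^+(1,n+3)$); $SO^+(1,n+3)$: those of determinant one; $SO^+(1,n+3,\mathbb{C})$: its complexification. $P_2=\mathrm{diag}(1,1,1,1,-1,1,\dots,1)$. Conformal Gauss map and frame. For a conformal immersion $y$ with coordinate $z$, the canonical lift $Y$ is the forward light-cone valued map with $[Y]=y$, $\langle Y_z,Y_{\bar z}\rangle=\frac12$. Put $Y_z=\frac12(e_1-ie_2)$; $N$ is the section of $V=\mathrm{Span}_{\mathbb R}\{Y,\mathrm{Re}Y_z,\mathrm{Im}Y_z,Y_{z\bar z}\}$ with $\langle N,Y_z\rangle=\langle N,N\rangle=0$, $\langle N,Y\rangle=-1$; $e_0=\frac1{\sqrt2}(Y+N)$, $\hat e_0=\frac1{\sqrt2}(-Y+N)$. The oriented conformal Gauss map $f$ is $p\mapsto V_p$, oriented by $(e_0,\hat e_0,e_1,e_2)$, with values in the space of oriented 4-dimensional Lorentzian subspaces. $y$ is Willmore iff $f$ is harmonic. The frame of $f$ is $F=(e_0,\hat e_0,e_1,e_2,\psi_1,\dots,\psi_n)\in SO^+(1,n+3)$ with $\psi_j$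 an orthonormal frame of $V^\perp$. Symmetry. An orientation reversing symmetry $(\mu,S)$ consists of an anti-holomorphic automorphism $\mu$ of $\mathbb{D}$ and a conformal diffeomorphism $S$ of $S^{n+2}$, mapping $y(\mathbb{D})$ onto itself, with $y(\mu(z))=S(y(z))$. For such a symmetry matrices $M(\lambda)$, $k$ as in the claim exist, with $M(1)=\hat S$. Loop groups. $\sigma=\mathrm{Ad}(\mathrm{diag}(-I_4,I_n))$; $\mathfrak{so}(1,n+3)=\mathfrak k\oplus\mathfrak p$ the $(\pm1)$-eigenspace decomposition; $\alpha=F^{-1}dF=\alpha'_{\mathfrak p}+\alpha_{\mathfrak k}+\alpha''_{\mathfrak p}$ ($'$, $''$: $(1,0)$- and $(0,1)$-parts). The extended frame $F(z,\bar z,\lambda)$, $\lambda\in S^1$, solves $dF=F(\lambda^{-1}\alpha'_{\mathfrak p}+\alpha_{\mathfrak k}+\lambda\alpha''_{\mathfrak p})$ with $F(z_0,\bar z_0,\lambda)=I$ (the surface being normalized so that $F(z_0,\bar z_0)=I$). $\Lambda G_\sigma$: loops $\gamma:S^1\to G$ with $\sigma\gamma(\lambda)=\gamma(-\lambda)$; $\Lambda^+G_\sigma$ ($G$ complex): those extending holomorphically to $|\lambda|<1$. Birkhoff decomposition: $F_-$ extends holomorphically to $|\lambda|>1$ including $\lambda=\infty$ with $F_-(z,\infty)=I$, and $F_+\in\Lambda^+SO^+(1,n+3,\mathbb{C})_\sigma$ with $F_+|_{\lambda=0}$ in the identity component of the $\sigma$-fixed subgroup of $SO^+(1,n+3,\mathbb{C})$;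 it exists for $z$ outside a discrete subset of $\mathbb{D}$, and $F_-$ is meromorphic in $z$. Complex conjugation is entrywise for $\lambda\in S^1$. $\eta\,\sharp\,W=W^{-1}\eta W+W^{-1}dW$. *)

theory Defs
  imports "HOL-Complex_Analysis.Complex_Analysis"
begin

text \<open>
  Conventions. The integer \<open>n \<ge> 1\<close> is the cardinality of the index type \<open>'n\<close>.
  The sphere of dimension \<open>n + 2\<close> is the unit sphere of \<open>real^(3 + 'n)\<close>; coordinates of the
  Lorentz space of dimension \<open>n + 4\<close> are indexed by \<open>(3 + 'n) option\<close>, where \<open>None\<close> is the
  time-like coordinate. The first four coordinates are \<open>None\<close>, \<open>Some (Inl 0)\<close>, \<open>Some (Inl 1)\<close>,
  \<open>Some (Inl 2)\<close>; the last \<open>n\<close> are \<open>Some (Inr j)\<close>, in the order of \<open>'n\<close>.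
  A map on the surface is a function of the point \<open>z\<close>, so \<open>F(z, cnj z, \<lambda>)\<close> is written
  \<open>F z \<lambda>\<close>.
\<close>

text \<open>For open \<open>U\<close> in finite dimension; iterated directional derivatives keep the codomain fixed.\<close>

primrec Ck_on :: "nat \<Rightarrow> 'a::real_normed_vector set \<Rightarrow> ('a \<Rightarrow> 'b::real_normed_vector) \<Rightarrow> bool" where
  "Ck_on 0 U f \<longleftrightarrow> continuous_on U f"
| "Ck_on (Suc k) U f \<longleftrightarrow> (\<forall>x\<in>U. f differentiable (at x)) \<and>
     (\<forall>v. Ck_on k U (\<lambda>x. frechet_derivative f (at x) v))"

definition smooth_on :: "'a::real_normed_vector set \<Rightarrow> ('a \<Rightarrow> 'b::real_normed_vector) \<Rightarrow> bool" where
  "smooth_on U f \<longleftrightarrow> (\<forall>k. Ck_on k U f)"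

definition d_z :: "(complex \<Rightarrow> complex) \<Rightarrow> complex \<Rightarrow> complex" where
  "d_z g z = (frechet_derivative g (at z) 1 - \<i> * frechet_derivative g (at z) \<i>) / 2"

definition d_zbar :: "(complex \<Rightarrow> complex) \<Rightarrow> complex \<Rightarrow> complex" where
  "d_zbar g z = (frechet_derivative g (at z) 1 + \<i> * frechet_derivative g (at z) \<i>) / 2"

definition conformal_immersion ::
    "complex set \<Rightarrow> (complex \<Rightarrow> real^(3 + 'n::finite)) \<Rightarrow> bool" where
  "conformal_immersion D y \<longleftrightarrow> smooth_on D y \<and> y ` D \<subseteq> sphere 0 1 \<and>
     (\<forall>z\<in>D. \<exists>c>0. \<forall>v w. frechet_derivative y (at z) v \<bullet> frechet_derivative y (at z) w = c * (v \<bullet> w))"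

text \<open>A map of the unit sphere is differentiated through its extension that is constant along rays.\<close>

definition radial :: "(real^'m \<Rightarrow> real^'m) \<Rightarrow> real^'m \<Rightarrow> real^'m" where
  "radial S x = S (x /\<^sub>R norm x)"

definition conformal_diffeo_sphere :: "(real^'m \<Rightarrow> real^'m) \<Rightarrow> bool" where
  "conformal_diffeo_sphere S \<longleftrightarrow>
     bij_betw S (sphere 0 1) (sphere 0 1) \<and>
     smooth_on (- {0}) (radial S) \<and>
     smooth_on (- {0}) (radial (inv_into (sphere 0 1) S)) \<and>
     (\<forall>x\<in>sphere 0 1. \<exists>c>0. \<forall>v w. v \<bullet> x = 0 \<and> w \<bullet> x = 0 \<longrightarrow>
        frechet_derivative (radial S) (at x) v \<bullet> frechet_derivative (radial S) (at x) w = c * (v \<bullet> w))"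

definition diag_mat :: "('i \<Rightarrow> 'a) \<Rightarrow> 'a::zero^'i^'i" where
  "diag_mat d = (\<chi> i j. if i = j then d i else 0)"

definition Ilor :: "'a::comm_ring_1^('m::finite option)^('m option)" where
  "Ilor = diag_mat (\<lambda>i. case i of None \<Rightarrow> - 1 | Some _ \<Rightarrow> 1)"

definition lor :: "'a::comm_ring_1^('m::finite option) \<Rightarrow> 'a^('m option) \<Rightarrow> 'a" where
  "lor x y = scalar_product x (Ilor *v y)"

definition forward_cone :: "(real^('m::finite option)) set" where
  "forward_cone = {x. lor x x = 0 \<and> x $ None > 0}"

definition Oplus :: "(real^('m::finite option)^('m option)) set" where
  "Oplus = {A. transpose A ** Ilor ** A = Ilor \<and> (\<forall>x\<in>forward_cone. A *v x \<in> forward_cone)}"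

definition SOplus :: "(real^('m::finite option)^('m option)) set" where
  "SOplus = {A \<in> Oplus. det A = 1}"

text \<open>The complexification of \<open>SOplus\<close>; time orientation has no complex counterpart.\<close>

definition SOplusC :: "(complex^('m::finite option)^('m option)) set" where
  "SOplusC = {A. transpose A ** Ilor ** A = Ilor \<and> det A = 1}"

definition lift1 :: "real^'m::finite \<Rightarrow> real^('m option)" where
  "lift1 x = (\<chi> i. case i of None \<Rightarrow> 1 | Some j \<Rightarrow> x $ j)"

definition induces :: "real^('m::finite option)^('m option) \<Rightarrow> (real^'m \<Rightarrow> real^'m) \<Rightarrow> bool" where
  "induces A S \<longleftrightarrow> (\<forall>x\<in>sphere 0 1. \<exists>r>0. A *v lift1 x = r *\<^sub>R lift1 (S x))"

definition block_ix :: "(3 + 'n) option \<Rightarrow> 3 option + 'n" where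
  "block_ix i = (case i of None \<Rightarrow> Inl None | Some (Inl a) \<Rightarrow> Inl (Some a) | Some (Inr b) \<Rightarrow> Inr b)"

definition blockdiag ::
    "'a::zero^(3 option)^(3 option) \<Rightarrow> 'a^'n::finite^'n \<Rightarrow> 'a^((3 + 'n) option)^((3 + 'n) option)" where
  "blockdiag A B = (\<chi> i j. case (block_ix i, block_ix j) of
       (Inl a, Inl b) \<Rightarrow> A $ a $ b
     | (Inr a, Inr b) \<Rightarrow> B $ a $ b
     | _ \<Rightarrow> 0)"

definition O13_On :: "(real^((3 + 'n::finite) option)^((3 + 'n) option)) set" where
  "O13_On = {blockdiag A B | A B. A \<in> Oplus \<and> orthogonal_matrix B}"

definition SO13_SOn :: "(real^((3 + 'n::finite) option)^((3 + 'n) option)) set" where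
  "SO13_SOn = {blockdiag A B | A B. A \<in> SOplus \<and> rotation_matrix B}"

definition P2 :: "complex^((3 + 'n::{finite,linorder}) option)^((3 + 'n) option)" where
  "P2 = diag_mat (\<lambda>i. if i = Some (Inr (Min UNIV)) then - 1 else 1)"

abbreviation cmat :: "real^'i^'j \<Rightarrow> complex^'i^'j" where
  "cmat \<equiv> map_matrix complex_of_real"

abbreviation cnj_mat :: "complex^'i^'j \<Rightarrow> complex^'i^'j" where
  "cnj_mat \<equiv> map_matrix cnj"

abbreviation cscale :: "complex \<Rightarrow> complex^'i^'j \<Rightarrow> complex^'i^'j" where
  "cscale c \<equiv> map_matrix ((*) c)"

definition sigma :: "'a::field^((3 + 'n::finite) option)^((3 + 'n) option) \<Rightarrow>
    'a^((3 + 'n) option)^((3 + 'n) option)" where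
  "sigma A = blockdiag (- mat 1) (mat 1) ** A ** matrix_inv (blockdiag (- mat 1) (mat 1))"

definition lift_z :: "(complex \<Rightarrow> real^'i) \<Rightarrow> complex \<Rightarrow> complex^'i" where
  "lift_z Y z = (\<chi> i. d_z (\<lambda>w. complex_of_real (Y w $ i)) z)"

definition lift_zbar :: "(complex \<Rightarrow> real^'i) \<Rightarrow> complex \<Rightarrow> complex^'i" where
  "lift_zbar Y z = (\<chi> i. d_zbar (\<lambda>w. complex_of_real (Y w $ i)) z)"

text \<open>The vector of second derivatives \<open>d_zbar (d_z Y)\<close> is real.\<close>

definition lift_zzbar :: "(complex \<Rightarrow> real^'i) \<Rightarrow> complex \<Rightarrow> real^'i" where
  "lift_zzbar Y z = (\<chi> i. Re (d_zbar (\<lambda>w. lift_z Y w $ i) z))"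

definition canonical_lift :: "complex set \<Rightarrow> (complex \<Rightarrow> real^'m::finite) \<Rightarrow>
    (complex \<Rightarrow> real^('m option)) \<Rightarrow> bool" where
  "canonical_lift D y Y \<longleftrightarrow> smooth_on D Y \<and>
     (\<forall>z\<in>D. Y z \<in> forward_cone \<and> (\<exists>r. Y z = r *\<^sub>R lift1 (y z)) \<and>
             lor (lift_z Y z) (lift_zbar Y z) = 1 / 2)"

definition gauss_space :: "(complex \<Rightarrow> real^'i) \<Rightarrow> complex \<Rightarrow> (real^'i) set" where
  "gauss_space Y z = span {Y z, \<chi> i. Re (lift_z Y z $ i), \<chi> i. Im (lift_z Y z $ i), lift_zzbar Y z}"

definition dual_lift :: "complex set \<Rightarrow> (complex \<Rightarrow> real^('m::finite option)) \<Rightarrow>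
    (complex \<Rightarrow> real^('m option)) \<Rightarrow> bool" where
  "dual_lift D Y N \<longleftrightarrow> (\<forall>z\<in>D. N z \<in> gauss_space Y z \<and>
     lor (\<chi> i. complex_of_real (N z $ i)) (lift_z Y z) = 0 \<and> lor (N z) (N z) = 0 \<and> lor (N z) (Y z) = - 1)"

text \<open>The vectors \<open>e\<^sub>0\<close>, hat \<open>e\<^sub>0\<close>, \<open>e\<^sub>1\<close>, \<open>e\<^sub>2\<close>, in this order.\<close>

definition gauss_basis :: "(complex \<Rightarrow> real^'i) \<Rightarrow> (complex \<Rightarrow> real^'i) \<Rightarrow> complex \<Rightarrow>
    3 option \<Rightarrow> real^'i" where
  "gauss_basis Y N z a = (case a of
       None \<Rightarrow> (1 / sqrt 2) *\<^sub>R (Y z + N z)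
     | Some b \<Rightarrow> if b = 0 then (1 / sqrt 2) *\<^sub>R (- Y z + N z)
                 else if b = 1 then (\<chi> i. 2 * Re (lift_z Y z $ i))
                 else (\<chi> i. - 2 * Im (lift_z Y z $ i)))"

text \<open>
  An oriented four-dimensional Lorentzian subspace is a point of
  \<open>SO\<^sup>+(1,n+3) / (SO\<^sup>+(1,3) \<times> SO(n))\<close>, i.e. a left coset: the set of all matrices in \<open>SOplus\<close>
  whose first four columns form a positively oriented basis of the subspace.
\<close>

definition oriented_space :: "(3 option \<Rightarrow> real^((3 + 'n::finite) option)) \<Rightarrow>
    (real^((3 + 'n) option)^((3 + 'n) option)) set" where
  "oriented_space e = {G \<in> SOplus. \<exists>A :: real^(3 option)^(3 option). det A > 0 \<and>
     (\<forall>a. column (map_option Inl a) G = (\<Sum>b\<in>UNIV. A $ b $ a *\<^sub>R e b))}"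

definition conformal_gauss_map :: "complex set \<Rightarrow> (complex \<Rightarrow> real^(3 + 'n::finite)) \<Rightarrow>
    (complex \<Rightarrow> (real^((3 + 'n) option)^((3 + 'n) option)) set) \<Rightarrow> bool" where
  "conformal_gauss_map D y f \<longleftrightarrow> (\<exists>Y N. canonical_lift D y Y \<and> dual_lift D Y N \<and>
     (\<forall>z\<in>D. f z = oriented_space (gauss_basis Y N z)))"

definition gauss_frame :: "complex set \<Rightarrow> (complex \<Rightarrow> real^(3 + 'n::finite)) \<Rightarrow>
    (complex \<Rightarrow> (real^((3 + 'n) option)^((3 + 'n) option)) set) \<Rightarrow>
    (complex \<Rightarrow> real^((3 + 'n) option)^((3 + 'n) option)) \<Rightarrow> bool" where
  "gauss_frame D y f F \<longleftrightarrow> smooth_on D F \<and> (\<exists>Y N. canonical_lift D y Y \<and> dual_lift D Y N \<and>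
     (\<forall>z\<in>D. F z \<in> SOplus \<and> F z \<in> f z \<and>
        (\<forall>a. column (map_option Inl a) (F z) = gauss_basis Y N z a) \<and>
        (\<forall>j. \<forall>x\<in>gauss_space Y z. lor (column (Some (Inr j)) (F z)) x = 0) \<and>
        (\<forall>i j. lor (column (Some (Inr i)) (F z)) (column (Some (Inr j)) (F z)) = (if i = j then 1 else 0))))"

text \<open>A one-form is a function of the point and of the (real) tangent vector.\<close>

definition mc_form :: "(complex \<Rightarrow> complex^'i^'i) \<Rightarrow> complex \<Rightarrow> complex \<Rightarrow> complex^'i^'i" where
  "mc_form F z v = matrix_inv (F z) ** frechet_derivative F (at z) v"

definition part10 :: "(complex \<Rightarrow> complex^'i^'i) \<Rightarrow> complex \<Rightarrow> complex^'i^'i" where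
  "part10 \<omega> v = (1 / 2) *\<^sub>R (\<omega> v - cscale \<i> (\<omega> (\<i> * v)))"

definition part01 :: "(complex \<Rightarrow> complex^'i^'i) \<Rightarrow> complex \<Rightarrow> complex^'i^'i" where
  "part01 \<omega> v = (1 / 2) *\<^sub>R (\<omega> v + cscale \<i> (\<omega> (\<i> * v)))"

definition k_part :: "complex^((3 + 'n::finite) option)^((3 + 'n) option) \<Rightarrow>
    complex^((3 + 'n) option)^((3 + 'n) option)" where
  "k_part A = (1 / 2) *\<^sub>R (A + sigma A)"

definition p_part :: "complex^((3 + 'n::finite) option)^((3 + 'n) option) \<Rightarrow>
    complex^((3 + 'n) option)^((3 + 'n) option)" where
  "p_part A = (1 / 2) *\<^sub>R (A - sigma A)"

text \<open>
  Vanishing tension field of \<open>z \<mapsto> F z K\<close>: the tangent bundle of the symmetric space is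
  associated with the isotropy representation on the \<open>(-1)\<close>-eigenspace of \<open>sigma\<close>, its Levi-Civita connection is the canonical
  one, and \<open>part10 \<omega> 1\<close>, \<open>part01 \<omega> 1\<close> are the values of \<open>\<omega>\<close> on \<open>\<partial>/\<partial>z\<close> and on its conjugate.
\<close>

definition tension_free_at :: "(complex \<Rightarrow> real^((3 + 'n::finite) option)^((3 + 'n) option)) \<Rightarrow>
    complex \<Rightarrow> bool" where
  "tension_free_at F z \<longleftrightarrow>
     (let \<alpha> = mc_form (\<lambda>w. cmat (F w));
          A = (\<lambda>w. part10 (\<lambda>v. p_part (\<alpha> w v)) 1);
          B = part01 (\<lambda>v. k_part (\<alpha> z v)) 1
      in (\<chi> i j. d_zbar (\<lambda>w. A w $ i $ j) z) + (B ** A z - A z ** B) = 0)"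

definition harmonic_map :: "complex set \<Rightarrow>
    (complex \<Rightarrow> (real^((3 + 'n::finite) option)^((3 + 'n) option)) set) \<Rightarrow> bool" where
  "harmonic_map D f \<longleftrightarrow> (\<exists>F. smooth_on D F \<and>
     (\<forall>z\<in>D. F z \<in> SOplus \<and> f z = {F z ** h | h. h \<in> SO13_SOn} \<and> tension_free_at F z))"

definition willmore_surface :: "complex set \<Rightarrow> (complex \<Rightarrow> real^(3 + 'n::finite)) \<Rightarrow> bool" where
  "willmore_surface D y \<longleftrightarrow> conformal_immersion D y \<and>
     (\<exists>f. conformal_gauss_map D y f \<and> harmonic_map D f)"

definition alpha_lambda :: "(complex \<Rightarrow> real^((3 + 'n::finite) option)^((3 + 'n) option)) \<Rightarrow>
    complex \<Rightarrow> complex \<Rightarrow> complex \<Rightarrow> complex^((3 + 'n) option)^((3 + 'n) option)" where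
  "alpha_lambda F l z v =
     (let \<alpha> = mc_form (\<lambda>w. cmat (F w)) z
      in cscale (inverse l) (part10 (\<lambda>u. p_part (\<alpha> u)) v) + k_part (\<alpha> v)
         + cscale l (part01 (\<lambda>u. p_part (\<alpha> u)) v))"

definition extended_frame :: "complex set \<Rightarrow> complex \<Rightarrow>
    (complex \<Rightarrow> real^((3 + 'n::finite) option)^((3 + 'n) option)) \<Rightarrow>
    (complex \<Rightarrow> complex \<Rightarrow> real^((3 + 'n) option)^((3 + 'n) option)) \<Rightarrow> bool" where
  "extended_frame D z0 F0 F \<longleftrightarrow> (\<forall>l\<in>sphere 0 1. F z0 l = mat 1 \<and>
     (\<forall>z\<in>D. ((\<lambda>w. cmat (F w l)) has_derivative (\<lambda>v. cmat (F z l) ** alpha_lambda F0 l z v)) (at z)))"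

definition pullback :: "(complex \<Rightarrow> complex) \<Rightarrow> (complex \<Rightarrow> complex \<Rightarrow> 'b) \<Rightarrow>
    complex \<Rightarrow> complex \<Rightarrow> 'b" where
  "pullback \<mu> \<omega> z v = \<omega> (\<mu> z) (frechet_derivative \<mu> (at z) v)"

definition gauge :: "(complex \<Rightarrow> complex \<Rightarrow> complex^'i^'i) \<Rightarrow> (complex \<Rightarrow> complex^'i^'i) \<Rightarrow>
    complex \<Rightarrow> complex \<Rightarrow> complex^'i^'i" (infixl \<open>\<sharp>\<close> 70) where
  "(\<eta> \<sharp> W) z v = matrix_inv (W z) ** \<eta> z v ** W z + matrix_inv (W z) ** frechet_derivative W (at z) v"

definition antiholomorphic_automorphism :: "complex set \<Rightarrow> (complex \<Rightarrow> complex) \<Rightarrow> bool" where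
  "antiholomorphic_automorphism D \<mu> \<longleftrightarrow> bij_betw \<mu> D D \<and> (\<lambda>z. cnj (\<mu> z)) holomorphic_on D"

definition orientation_reversing_symmetry :: "complex set \<Rightarrow> (complex \<Rightarrow> real^(3 + 'n::finite)) \<Rightarrow>
    (complex \<Rightarrow> complex) \<Rightarrow> (real^(3 + 'n) \<Rightarrow> real^(3 + 'n)) \<Rightarrow> bool" where
  "orientation_reversing_symmetry D y \<mu> S \<longleftrightarrow>
     antiholomorphic_automorphism D \<mu> \<and> conformal_diffeo_sphere S \<and>
     S ` (y ` D) = y ` D \<and> (\<forall>z\<in>D. y (\<mu> z) = S (y z))"

text \<open>A loop is a function on the complex numbers of which only the values on the unit circle matter.\<close>

definition loop_group :: "('a::real_normed_field^((3 + 'n::finite) option)^((3 + 'n) option)) set \<Rightarrow>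
    (complex \<Rightarrow> 'a^((3 + 'n) option)^((3 + 'n) option)) set" where
  "loop_group G = {\<gamma>. continuous_on (sphere 0 1) \<gamma> \<and>
     (\<forall>l\<in>sphere 0 1. \<gamma> l \<in> G \<and> sigma (\<gamma> l) = \<gamma> (- l))}"

definition mat_holomorphic_on :: "(complex \<Rightarrow> complex^'i^'j) \<Rightarrow> complex set \<Rightarrow> bool" where
  "mat_holomorphic_on g U \<longleftrightarrow> (\<forall>i j. (\<lambda>z. g z $ i $ j) holomorphic_on U)"

definition extends_inside :: "(complex \<Rightarrow> complex^'i^'j) \<Rightarrow> (complex \<Rightarrow> complex^'i^'j) \<Rightarrow> bool" where
  "extends_inside \<gamma> g \<longleftrightarrow> continuous_on (cball 0 1) g \<and> mat_holomorphic_on g (ball 0 1) \<and>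
     (\<forall>l\<in>sphere 0 1. g l = \<gamma> l)"

definition extends_outside :: "(complex \<Rightarrow> complex^'i^'j) \<Rightarrow> (complex \<Rightarrow> complex^'i^'j) \<Rightarrow> bool" where
  "extends_outside \<gamma> g \<longleftrightarrow> continuous_on (- ball 0 1) g \<and> mat_holomorphic_on g (- cball 0 1) \<and>
     (\<forall>l\<in>sphere 0 1. g l = \<gamma> l)"

definition loop_plus :: "(complex^((3 + 'n::finite) option)^((3 + 'n) option)) set \<Rightarrow>
    (complex \<Rightarrow> complex^((3 + 'n) option)^((3 + 'n) option)) set" where
  "loop_plus G = {\<gamma> \<in> loop_group G. \<exists>g. extends_inside \<gamma> g}"

definition loop_minus_star :: "(complex^((3 + 'n::finite) option)^((3 + 'n) option)) set \<Rightarrow>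
    (complex \<Rightarrow> complex^((3 + 'n) option)^((3 + 'n) option)) set" where
  "loop_minus_star G = {\<gamma> \<in> loop_group G. \<exists>g. extends_outside \<gamma> g \<and> (g \<longlongrightarrow> mat 1) at_infinity}"

definition KC0 :: "(complex^((3 + 'n::finite) option)^((3 + 'n) option)) set" where
  "KC0 = connected_component_set {A \<in> SOplusC. sigma A = A} (mat 1)"

text \<open>\<open>X\<close> is the discrete exceptional set, off which the factors are defined.\<close>

definition birkhoff_decomposition :: "complex set \<Rightarrow> complex set \<Rightarrow>
    (complex \<Rightarrow> complex \<Rightarrow> real^((3 + 'n::finite) option)^((3 + 'n) option)) \<Rightarrow>
    (complex \<Rightarrow> complex \<Rightarrow> complex^((3 + 'n) option)^((3 + 'n) option)) \<Rightarrow>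
    (complex \<Rightarrow> complex \<Rightarrow> complex^((3 + 'n) option)^((3 + 'n) option)) \<Rightarrow> bool" where
  "birkhoff_decomposition D X F Fm Fp \<longleftrightarrow>
     X \<subseteq> D \<and> X sparse_in D \<and>
     (\<forall>z\<in>D - X.
        (\<forall>l\<in>sphere 0 1. cmat (F z l) = Fm z l ** Fp z l) \<and>
        Fm z \<in> loop_minus_star SOplusC \<and>
        Fp z \<in> loop_plus SOplusC \<and> (\<exists>g. extends_inside (Fp z) g \<and> g 0 \<in> KC0)) \<and>
     (\<forall>l\<in>sphere 0 1. mat_holomorphic_on (\<lambda>z. Fm z l) (D - X) \<and>
        (\<forall>i j. (\<lambda>z. Fm z l $ i $ j) meromorphic_on D))"

definition W_plus :: "(complex \<Rightarrow> complex) \<Rightarrow>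
    (complex \<Rightarrow> real^((3 + 'n::finite) option)^((3 + 'n) option)) \<Rightarrow>
    (complex \<Rightarrow> complex \<Rightarrow> complex^((3 + 'n) option)^((3 + 'n) option)) \<Rightarrow>
    complex \<Rightarrow> complex \<Rightarrow> complex^((3 + 'n) option)^((3 + 'n) option)" where
  "W_plus \<mu> k Fp z l = cnj_mat (Fp z (inverse l)) ** cmat (k z) ** matrix_inv (Fp (\<mu> z) l)"

definition normalized_potential :: "(complex \<Rightarrow> complex \<Rightarrow> complex^'i^'i) \<Rightarrow>
    complex \<Rightarrow> complex \<Rightarrow> complex \<Rightarrow> complex^'i^'i" where
  "normalized_potential Fm l = mc_form (\<lambda>z. Fm z l)"

end

theory Submission
  imports Defs
begin

text \<open>
  Since the frame \<open>F\<close> is real, conjugating the Birkhoff decomposition at \<open>inverse l\<close> and inserting it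
  into \<open>F (\<mu> z) l = M l ** F z (inverse l) ** k z\<close> gives the formula for \<open>Fm (\<mu> z) l\<close>. Hence
  \<open>W\<close> can be written in two ways. As
  \<open>cnj (Fm z (inverse l))\<inverse> (M l)\<inverse> (Fm (\<mu> z) l)\<close> it is a twisted loop in the complex
  Lorentz group and antiholomorphic in \<open>z\<close>; as
  \<open>cnj (Fp z (inverse l)) (k z) (Fp (\<mu> z) l)\<inverse>\<close> it extends to the inside of the circle and has
  determinant \<open>det (k z)\<close>, which equals \<open>det Shat\<close>. The transformation of the potentials is the
  logarithmic derivative of the formula for \<open>Fm (\<mu> z) l\<close>.
\<close>

section \<open>Matrices\<close>

lemma cnj_mat_mult: "cnj_mat (A ** B) = cnj_mat A ** cnj_mat B"
  by (simp add: vec_eq_iff matrix_matrix_mult_def)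

lemma cmat_mult: "cmat (A ** B) = cmat A ** cmat B"
  by (simp add: vec_eq_iff matrix_matrix_mult_def)

lemma cnj_mat_transpose: "cnj_mat (transpose A) = transpose (cnj_mat A)"
  by (simp add: vec_eq_iff transpose_def)

lemma cmat_transpose: "cmat (transpose A) = transpose (cmat A)"
  by (simp add: vec_eq_iff transpose_def)

lemma cnj_mat_cnj_mat [simp]: "cnj_mat (cnj_mat A) = A"
  by (simp add: vec_eq_iff)

lemma cnj_mat_cmat [simp]: "cnj_mat (cmat A) = cmat A"
  by (simp add: vec_eq_iff)

lemma det_cnj_mat: "det (cnj_mat A) = cnj (det A)"
  by (simp add: det_def)

lemma det_cmat: "det (cmat A) = complex_of_real (det A)"
  by (simp add: det_def)

text \<open>\<open>matrix_inv\<close> is a choice of a two-sided inverse. Over a field a left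
  inverse of a square matrix is two-sided and hence unique, so the choice is determined.\<close>

lemma matrix_inv_eqI:
  fixes A B :: "'a::field^'n^'n"
  assumes "B ** A = mat 1"
  shows "matrix_inv A = B"
proof -
  have *: "A ** B = mat 1"
    using assms matrix_left_right_inverse by blast
  have "A ** matrix_inv A = mat 1 \<and> matrix_inv A ** A = mat 1"
    unfolding matrix_inv_def using assms * by (intro someI_ex[where P = "\<lambda>A'. A ** A' = mat 1 \<and> A' ** A = mat 1"]) blast
  then show ?thesis
    by (metis assms matrix_mul_assoc matrix_mul_lid matrix_mul_rid)
qed

text \<open>Source of both the continuity of products of loops and the Leibniz rule for the
  potentials.\<close>

lemma bounded_bilinear_matrix_mult:
  "bounded_bilinear ((**) :: complex^'n^'m \<Rightarrow> complex^'k^'n \<Rightarrow> complex^'k^'m)"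
  unfolding bilinear_conv_bounded_bilinear[symmetric] bilinear_def
  by (auto intro!: linearI simp: vec_eq_iff matrix_matrix_mult_def algebra_simps sum.distrib
      scaleR_sum_right)

lemma bounded_linear_cnj_mat: "bounded_linear (cnj_mat :: complex^'n^'m \<Rightarrow> complex^'n^'m)"
  unfolding linear_conv_bounded_linear[symmetric]
  by (auto intro!: linearI simp: vec_eq_iff)

lemma bounded_linear_cmat: "bounded_linear (cmat :: real^'n^'m \<Rightarrow> complex^'n^'m)"
  unfolding linear_conv_bounded_linear[symmetric]
  by (auto intro!: linearI simp: vec_eq_iff scaleR_conv_of_real[where 'a = complex])

lemma bounded_linear_transpose:
  "bounded_linear (transpose :: complex^'n^'m \<Rightarrow> complex^'m^'n)"
  unfolding linear_conv_bounded_linear[symmetric]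
  by (auto intro!: linearI simp: vec_eq_iff transpose_def)

lemmas continuous_on_matrix_mult = bounded_bilinear.continuous_on[OF bounded_bilinear_matrix_mult]
lemmas continuous_on_cnj_mat = bounded_linear.continuous_on[OF bounded_linear_cnj_mat]
lemmas continuous_on_cmat = bounded_linear.continuous_on[OF bounded_linear_cmat]
lemmas continuous_on_transpose = bounded_linear.continuous_on[OF bounded_linear_transpose]

lemma differentiable_bounded_linear:
  "bounded_linear h \<Longrightarrow> f differentiable F \<Longrightarrow> (\<lambda>x. h (f x)) differentiable F"
  unfolding differentiable_def by (blast intro: bounded_linear.has_derivative)

lemma mat_holomorphic_on_const: "mat_holomorphic_on (\<lambda>z. A) U"
  by (simp add: mat_holomorphic_on_def)

lemma mat_holomorphic_on_mult:
  assumes "mat_holomorphic_on f U" "mat_holomorphic_on g U"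
  shows "mat_holomorphic_on (\<lambda>z. f z ** g z) U"
  using assms unfolding mat_holomorphic_on_def matrix_matrix_mult_def
  by (auto intro!: holomorphic_intros)

lemma mat_holomorphic_on_transpose:
  assumes "mat_holomorphic_on f U"
  shows "mat_holomorphic_on (\<lambda>z. transpose (f z)) U"
  using assms by (simp add: mat_holomorphic_on_def transpose_def)

lemma mat_holomorphic_on_subset:
  "mat_holomorphic_on f U \<Longrightarrow> V \<subseteq> U \<Longrightarrow> mat_holomorphic_on f V"
  unfolding mat_holomorphic_on_def using holomorphic_on_subset by blast

lemma mat_holomorphic_on_transform:
  assumes "mat_holomorphic_on f U" "\<And>z. z \<in> U \<Longrightarrow> f z = g z"
  shows "mat_holomorphic_on g U"
  unfolding mat_holomorphic_on_def
proof (intro allI)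
  fix i j
  have "(\<lambda>z. f z $ i $ j) holomorphic_on U"
    using assms(1) by (simp add: mat_holomorphic_on_def)
  then show "(\<lambda>z. g z $ i $ j) holomorphic_on U"
    by (rule holomorphic_transform) (simp add: assms(2))
qed

lemma mat_holomorphic_on_compose:
  assumes "mat_holomorphic_on f V" "g holomorphic_on U" "g ` U \<subseteq> V"
  shows "mat_holomorphic_on (\<lambda>z. f (g z)) U"
  using assms unfolding mat_holomorphic_on_def
  by (metis (no_types, lifting) comp_apply holomorphic_on_compose_gen holomorphic_transform)

text \<open>Schwarz reflection, entry by entry. It serves twice: in the loop parameter, to extend
  conjugated loops, and in the point of the surface, to deal with the antiholomorphic
  \<open>\<mu>\<close>.\<close>

lemma mat_holomorphic_on_cnj_cnj:
  assumes "mat_holomorphic_on f U" "open U"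
  shows "mat_holomorphic_on (\<lambda>z. cnj_mat (f (cnj z))) (cnj ` U)"
proof -
  have "open (cnj ` U)"
    unfolding image_cnj_conv_vimage_cnj using assms(2) by (intro open_vimage) auto
  moreover have "cnj ` cnj ` U = U"
    by (simp add: image_image)
  ultimately have "cnj \<circ> (\<lambda>z. f z $ i $ j) \<circ> cnj holomorphic_on cnj ` U" for i j
    using assms(1) unfolding mat_holomorphic_on_def by (metis holomorphic_on_compose_cnj_cnj)
  then show ?thesis
    by (simp add: mat_holomorphic_on_def comp_def)
qed

text \<open>Passes from complex differentiability of the entries to the real Frechet derivative in
  which \<open>mc_form\<close> and \<open>gauge\<close> are written.\<close>

lemma mat_holomorphic_on_imp_differentiable:
  fixes f :: "complex \<Rightarrow> complex^'n^'m"
  assumes "mat_holomorphic_on f U" "open U" "z \<in> U"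
  shows "f differentiable (at z)"
proof -
  have "(\<lambda>w. f w $ i $ j) differentiable (at z)" for i j
    using assms unfolding mat_holomorphic_on_def
    by (metis field_differentiable_imp_differentiable holomorphic_on_imp_differentiable_at)
  then have "(\<lambda>w. f w \<bullet> b) differentiable (at z)" if b: "b \<in> Basis" for b
  proof -
    obtain i j c where "b = axis i (axis j c)"
      using b by (auto simp: Basis_vec_def)
    then have "(\<lambda>w. f w \<bullet> b) = (\<lambda>w. f w $ i $ j \<bullet> c)"
      by (simp add: inner_axis)
    then show ?thesis
      using \<open>\<And>i j. (\<lambda>w. f w $ i $ j) differentiable (at z)\<close>
      by (simp add: differentiable_inner)
  qed
  then show ?thesis
    by (subst differentiable_componentwise_within) auto
qed

section \<open>The Lorentz form and the involution\<close>

text \<open>One definition for real and complex matrices; with no condition on the determinant, it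
  also contains the values of \<open>W_plus\<close> of determinant \<open>- 1\<close>.\<close>

definition lorentz_group :: "('a::comm_ring_1^('m::finite option)^('m option)) set" where
  "lorentz_group = {A. transpose A ** Ilor ** A = Ilor}"

text \<open>The adjoint for the Lorentz form. On the group it is the inverse; being linear in
  \<open>A\<close>, it visibly preserves continuity and holomorphy.\<close>

definition lorentz_adj :: "'a::comm_ring_1^('m::finite option)^('m option) \<Rightarrow>
    'a^('m option)^('m option)" where
  "lorentz_adj A = Ilor ** transpose A ** Ilor"

lemma diag_mat_mult: "diag_mat d ** diag_mat e = diag_mat (\<lambda>i. d i * (e i :: 'a::semiring_1))"
  by (auto simp: vec_eq_iff matrix_matrix_mult_def diag_mat_def if_distrib[of "\<lambda>x. x * _"]
      cong: if_cong)

lemma transpose_diag_mat: "transpose (diag_mat d) = diag_mat d"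
  by (auto simp: vec_eq_iff transpose_def diag_mat_def)

lemma mat_1_eq_diag_mat: "mat 1 = diag_mat (\<lambda>i. 1)"
  by (simp add: mat_def diag_mat_def)

lemma Ilor_mult_Ilor: "Ilor ** Ilor = mat 1"
  unfolding Ilor_def diag_mat_mult mat_1_eq_diag_mat
  by (rule arg_cong[where f = diag_mat]) (auto split: option.splits)

lemma transpose_Ilor: "transpose Ilor = Ilor"
  by (simp add: Ilor_def transpose_diag_mat)

lemma cnj_mat_Ilor: "cnj_mat Ilor = Ilor"
  by (auto simp: vec_eq_iff Ilor_def diag_mat_def split: option.splits)

lemma cmat_Ilor: "cmat Ilor = Ilor"
  by (auto simp: vec_eq_iff Ilor_def diag_mat_def split: option.splits)

lemma lorentz_adj_mult:
  assumes "A \<in> lorentz_group"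
  shows "lorentz_adj A ** A = mat 1"
  using assms
  by (simp add: lorentz_adj_def lorentz_group_def matrix_mul_assoc[symmetric] Ilor_mult_Ilor)

lemma matrix_inv_lorentz:
  fixes A :: "'a::field^('m::finite option)^('m option)"
  assumes "A \<in> lorentz_group"
  shows "matrix_inv A = lorentz_adj A"
  by (rule matrix_inv_eqI) (rule lorentz_adj_mult[OF assms])

lemma mult_lorentz_adj:
  fixes A :: "'a::field^('m::finite option)^('m option)"
  assumes "A \<in> lorentz_group"
  shows "A ** lorentz_adj A = mat 1"
  using lorentz_adj_mult[OF assms] matrix_left_right_inverse by blast

lemma lorentz_group_mult:
  assumes "A \<in> lorentz_group" "B \<in> lorentz_group"
  shows "A ** B \<in> lorentz_group"
  using assms by (simp add: lorentz_group_def matrix_transpose_mul) (metis matrix_mul_assoc)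

text \<open>Since \<open>transpose (lorentz_adj A)\<close> is \<open>Ilor ** A ** Ilor\<close>, the
  defining equation reduces to the adjoint being a right inverse.\<close>

lemma lorentz_group_adj:
  fixes A :: "'a::field^('m::finite option)^('m option)"
  assumes "A \<in> lorentz_group"
  shows "lorentz_adj A \<in> lorentz_group"
proof -
  have "transpose (lorentz_adj A) ** Ilor ** lorentz_adj A
      = Ilor ** (A ** (Ilor ** Ilor) ** lorentz_adj A)"
    by (simp add: lorentz_adj_def matrix_transpose_mul transpose_Ilor matrix_mul_assoc)
  then show ?thesis
    using mult_lorentz_adj[OF assms] by (simp add: lorentz_group_def Ilor_mult_Ilor)
qed

lemma lorentz_group_cnj_mat:
  assumes "A \<in> lorentz_group"
  shows "cnj_mat A \<in> lorentz_group"
proof -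
  have "cnj_mat (transpose A ** Ilor ** A) = cnj_mat Ilor"
    using assms by (simp add: lorentz_group_def)
  then show ?thesis
    by (simp add: lorentz_group_def cnj_mat_mult cnj_mat_transpose cnj_mat_Ilor)
qed

lemma lorentz_group_cmat:
  assumes "A \<in> lorentz_group"
  shows "cmat A \<in> lorentz_group"
proof -
  have "cmat (transpose A ** Ilor ** A) = cmat Ilor"
    using assms by (simp add: lorentz_group_def)
  then show ?thesis
    by (simp add: lorentz_group_def cmat_mult cmat_transpose cmat_Ilor)
qed

lemma SOplusC_eq: "SOplusC = {A \<in> lorentz_group. det A = 1}"
  by (auto simp: SOplusC_def lorentz_group_def)

abbreviation Jblock :: "'a::comm_ring_1^((3 + 'n::finite) option)^((3 + 'n) option)" where
  "Jblock \<equiv> blockdiag (- mat 1) (mat 1)"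

lemma Jblock_eq_diag_mat:
  "Jblock = diag_mat (\<lambda>i. case block_ix i of Inl _ \<Rightarrow> - 1 | Inr _ \<Rightarrow> 1)"
  by (auto simp: vec_eq_iff blockdiag_def diag_mat_def mat_def block_ix_def
      split: option.splits sum.splits)

lemma Jblock_mult_Jblock: "Jblock ** Jblock = mat 1"
  unfolding Jblock_eq_diag_mat diag_mat_mult unfolding mat_1_eq_diag_mat
  by (rule arg_cong[where f = diag_mat]) (auto split: sum.splits)

text \<open>\<open>Jblock\<close> is its own inverse. Without \<open>matrix_inv\<close>, the
  behaviour of \<open>sigma\<close> under products, transposes and conjugation is a direct
  computation.\<close>

lemma sigma_eq: "sigma A = Jblock ** A ** Jblock"
  unfolding sigma_def by (simp add: matrix_inv_eqI[OF Jblock_mult_Jblock])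

lemma sigma_mult: "sigma (A ** B) = sigma A ** sigma B"
proof -
  have "sigma A ** sigma B = Jblock ** A ** (Jblock ** Jblock) ** B ** Jblock"
    by (simp only: sigma_eq matrix_mul_assoc)
  then show ?thesis
    by (simp add: Jblock_mult_Jblock sigma_eq matrix_mul_assoc)
qed

lemma sigma_transpose: "sigma (transpose A) = transpose (sigma A)"
  by (simp add: sigma_eq matrix_transpose_mul matrix_mul_assoc Jblock_eq_diag_mat transpose_diag_mat)

text \<open>Diagonal matrices commute and the diagonal entries of \<open>Jblock\<close> square to 1.
  Applied to \<open>Ilor\<close> and \<open>P2\<close>.\<close>

lemma sigma_diag_mat: "sigma (diag_mat d) = diag_mat d"
  unfolding sigma_eq Jblock_eq_diag_mat diag_mat_mult
  by (rule arg_cong[where f = diag_mat]) (auto split: sum.splits)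

lemma sigma_lorentz_adj: "sigma (lorentz_adj A) = lorentz_adj (sigma A)"
  by (simp add: lorentz_adj_def sigma_mult sigma_transpose) (simp add: Ilor_def sigma_diag_mat)

lemma sigma_cnj_mat:
  fixes A :: "complex^((3 + 'n::finite) option)^((3 + 'n) option)"
  shows "sigma (cnj_mat A) = cnj_mat (sigma A)"
proof -
  have "cnj_mat Jblock = (Jblock :: complex^((3 + 'n) option)^((3 + 'n) option))"
    by (auto simp: vec_eq_iff Jblock_eq_diag_mat diag_mat_def split: sum.splits)
  then show ?thesis
    by (simp add: sigma_eq cnj_mat_mult)
qed

lemma sigma_cmat:
  fixes A :: "real^((3 + 'n::finite) option)^((3 + 'n) option)"
  shows "sigma (cmat A) = cmat (sigma A)"
proof -
  have "cmat Jblock = (Jblock :: complex^((3 + 'n) option)^((3 + 'n) option))"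
    by (auto simp: vec_eq_iff Jblock_eq_diag_mat diag_mat_def split: sum.splits)
  then show ?thesis
    by (simp add: sigma_eq cmat_mult)
qed

lemma sigma_P2: "sigma P2 = P2"
  by (simp add: P2_def sigma_diag_mat)

lemma P2_lorentz: "P2 \<in> lorentz_group"
  unfolding lorentz_group_def P2_def Ilor_def mem_Collect_eq transpose_diag_mat diag_mat_mult
  by (rule arg_cong[where f = diag_mat]) (auto split: option.splits)

lemma det_P2: "det (P2 :: complex^((3 + 'n::{finite,linorder}) option)^((3 + 'n) option)) = - 1"
proof -
  let ?P = "P2 :: complex^((3 + 'n) option)^((3 + 'n) option)"
  have "det ?P = (\<Prod>i\<in>UNIV. ?P $ i $ i)"
    by (rule det_diagonal) (simp add: P2_def diag_mat_def)
  \<comment> \<open>The linear order on \<open>'n\<close> singles out one index, so exactly one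
    factor is \<open>- 1\<close>.\<close>
  also have "\<dots> = (\<Prod>i\<in>(UNIV :: (3 + 'n) option set). if i = Some (Inr (Min UNIV)) then - 1 else 1)"
    by (simp add: P2_def diag_mat_def)
  finally show ?thesis
    by simp
qed

section \<open>Twisted loops\<close>

text \<open>Only values on the circle enter, and \<open>- l\<close> stays on it. Formulas for
  \<open>W_plus\<close> that hold only there can thus be substituted.\<close>

lemma loop_group_cong:
  assumes "\<And>l. l \<in> sphere 0 1 \<Longrightarrow> \<gamma> l = \<delta> l"
  shows "\<gamma> \<in> loop_group G \<longleftrightarrow> \<delta> \<in> loop_group G"
proof -
  have "continuous_on (sphere 0 1) \<gamma> \<longleftrightarrow> continuous_on (sphere 0 1) \<delta>"
    using assms by (intro continuous_on_cong) auto
  moreover have "- l \<in> sphere 0 1" if "l \<in> sphere 0 1" for l :: complex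
    using that by simp
  ultimately show ?thesis
    using assms unfolding loop_group_def mem_Collect_eq by metis
qed

lemma loop_group_mult:
  assumes "\<gamma> \<in> loop_group (lorentz_group :: (complex^_^_) set)" "\<delta> \<in> loop_group lorentz_group"
  shows "(\<lambda>l. \<gamma> l ** \<delta> l) \<in> loop_group lorentz_group"
  using assms by (auto simp: loop_group_def sigma_mult lorentz_group_mult
      intro!: continuous_on_matrix_mult)

lemma loop_group_const:
  assumes "A \<in> G" "sigma A = A"
  shows "(\<lambda>l. A) \<in> loop_group G"
  using assms by (simp add: loop_group_def)

lemma loop_group_adj:
  assumes "\<gamma> \<in> loop_group (lorentz_group :: (complex^_^_) set)"
  shows "(\<lambda>l. lorentz_adj (\<gamma> l)) \<in> loop_group lorentz_group"
  using assms unfolding loop_group_def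
  by (auto simp: sigma_lorentz_adj lorentz_group_adj)
    (auto simp: lorentz_adj_def intro!: continuous_on_matrix_mult continuous_on_transpose continuous_on_const)

text \<open>Inversion preserves the circle and commutes with \<open>l \<mapsto> - l\<close>, and
  conjugation commutes with \<open>sigma\<close>, so the twisting condition survives.\<close>

lemma loop_group_cnj_inverse:
  assumes "\<gamma> \<in> loop_group lorentz_group"
  shows "(\<lambda>l. cnj_mat (\<gamma> (inverse l))) \<in> loop_group lorentz_group"
proof -
  have "continuous_on (sphere 0 1) (\<lambda>l. \<gamma> (inverse l))"
    using assms by (intro continuous_on_compose2[of "sphere 0 1" \<gamma> _ inverse])
      (auto simp: loop_group_def norm_inverse intro!: continuous_on_inverse)
  then show ?thesis
    using assms unfolding loop_group_def
    by (auto simp: sigma_cnj_mat norm_inverse inverse_minus_eq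
        intro!: continuous_on_cnj_mat lorentz_group_cnj_mat)
qed

lemma loop_group_cmat:
  assumes "\<gamma> \<in> loop_group Oplus"
  shows "(\<lambda>l. cmat (\<gamma> l)) \<in> loop_group lorentz_group"
proof -
  have "Oplus \<subseteq> lorentz_group"
    by (auto simp: Oplus_def lorentz_group_def)
  then show ?thesis
    using assms unfolding loop_group_def
    by (auto simp: sigma_cmat intro!: continuous_on_cmat lorentz_group_cmat)
qed

text \<open>Separates the determinant from the twisting, so that one argument for
  \<open>W_plus\<close> in \<open>lorentz_group\<close> serves both signs of
  \<open>det Shat\<close>.\<close>

lemma loop_group_SOplusC_iff:
  "\<gamma> \<in> loop_group SOplusC \<longleftrightarrow> \<gamma> \<in> loop_group lorentz_group \<and> (\<forall>l\<in>sphere 0 1. det (\<gamma> l) = 1)"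
  by (auto simp: loop_group_def SOplusC_eq)

lemma loop_group_memD: "\<gamma> \<in> loop_group G \<Longrightarrow> l \<in> sphere 0 1 \<Longrightarrow> \<gamma> l \<in> G"
  by (simp add: loop_group_def)

lemma extends_inside_const: "extends_inside (\<lambda>l. A) (\<lambda>l. A)"
  by (simp add: extends_inside_def mat_holomorphic_on_const)

lemma extends_inside_mult:
  assumes "extends_inside \<gamma> g" "extends_inside \<delta> h"
  shows "extends_inside (\<lambda>l. \<gamma> l ** \<delta> l) (\<lambda>l. g l ** h l)"
  using assms unfolding extends_inside_def
  by (auto intro!: continuous_on_matrix_mult mat_holomorphic_on_mult)

text \<open>By linearity of \<open>lorentz_adj\<close> the inverse loop extends without any check
  that \<open>g\<close> stays invertible inside the disc.\<close>

lemma extends_inside_adj: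
  assumes "extends_inside \<gamma> g"
  shows "extends_inside (\<lambda>l. lorentz_adj (\<gamma> l)) (\<lambda>l. lorentz_adj (g l))"
  using assms unfolding extends_inside_def lorentz_adj_def
  by (auto intro!: continuous_on_matrix_mult mat_holomorphic_on_mult continuous_on_transpose
      mat_holomorphic_on_transpose mat_holomorphic_on_const)

lemma cnj_eq_inverse_on_sphere: "l \<in> sphere 0 1 \<Longrightarrow> cnj l = inverse l"
  by (rule inverse_unique[symmetric]) (simp flip: complex_norm_square)

text \<open>On the unit circle \<open>inverse l = cnj l\<close>, so Schwarz reflection provides the extension.\<close>

lemma extends_inside_cnj_inverse:
  assumes "extends_inside \<gamma> g"
  shows "extends_inside (\<lambda>l. cnj_mat (\<gamma> (inverse l))) (\<lambda>l. cnj_mat (g (cnj l)))"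
proof -
  have "continuous_on (cball 0 1) (\<lambda>l. g (cnj l))"
    using assms by (intro continuous_on_compose2[of "cball 0 1" g _ cnj])
      (auto simp: extends_inside_def intro!: continuous_on_cnj)
  moreover have "cnj ` ball 0 1 = ball 0 1"
    by (auto simp: image_cnj_conv_vimage_cnj)
  then have "mat_holomorphic_on (\<lambda>l. cnj_mat (g (cnj l))) (ball 0 1)"
    using assms mat_holomorphic_on_cnj_cnj[of g "ball 0 1"] unfolding extends_inside_def by simp
  moreover have "g (cnj l) = \<gamma> (inverse l)" if "l \<in> sphere 0 1" for l
  proof -
    have "inverse l \<in> sphere 0 1"
      using that by (simp add: norm_inverse)
    then show ?thesis
      using assms that unfolding extends_inside_def by (metis cnj_eq_inverse_on_sphere)
  qed
  ultimately show ?thesis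
    unfolding extends_inside_def by (auto intro!: continuous_on_cnj_mat)
qed

lemma extends_inside_cong:
  assumes "extends_inside \<gamma> g" "\<And>l. l \<in> sphere 0 1 \<Longrightarrow> \<gamma> l = \<delta> l"
  shows "extends_inside \<delta> g"
  using assms by (simp add: extends_inside_def)

text \<open>A sparse set does not accumulate at points of \<open>D\<close>, so a point of
  \<open>D\<close> off \<open>X\<close> has a whole neighbourhood off \<open>X\<close>.\<close>

lemma open_diff_sparse:
  fixes D X :: "'a::t1_space set"
  assumes "open D" "X sparse_in D"
  shows "open (D - X)"
proof (rule topological_space_class.openI)
  fix x assume x: "x \<in> D - X"
  then obtain B where "open B" "x \<in> B" "\<forall>y\<in>B. y \<noteq> x \<longrightarrow> y \<notin> X"
    using sparse_in_not_in[OF assms(2), of x] by blast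
  then have "open (B \<inter> D)" "x \<in> B \<inter> D" "B \<inter> D \<subseteq> D - X"
    using x assms(1) by auto
  then show "\<exists>T. open T \<and> x \<in> T \<and> T \<subseteq> D - X"
    by blast
qed

lemma open_vimage_Int:
  assumes "continuous_on S f" "open S" "open T"
  shows "open {x \<in> S. f x \<in> T}"
proof -
  have "{x \<in> S. f x \<in> T} = f -` T \<inter> S"
    by auto
  then show ?thesis
    using continuous_on_open_vimage[OF assms(2), of f] assms(1,3) by auto
qed

theorem theorem3p4:
  fixes D X :: "complex set" and z0 :: complex
    and y :: "complex \<Rightarrow> real^(3 + 'n::{finite,linorder})"
    and f :: "complex \<Rightarrow> (real^((3 + 'n) option)^((3 + 'n) option)) set"
    and \<mu> :: "complex \<Rightarrow> complex" and S :: "real^(3 + 'n) \<Rightarrow> real^(3 + 'n)"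
    and Shat :: "real^((3 + 'n) option)^((3 + 'n) option)"
    and F0 k :: "complex \<Rightarrow> real^((3 + 'n) option)^((3 + 'n) option)"
    and F :: "complex \<Rightarrow> complex \<Rightarrow> real^((3 + 'n) option)^((3 + 'n) option)"
    and M :: "complex \<Rightarrow> real^((3 + 'n) option)^((3 + 'n) option)"
    and Fm Fp :: "complex \<Rightarrow> complex \<Rightarrow> complex^((3 + 'n) option)^((3 + 'n) option)"
  assumes D: "D = ball 0 1 \<or> D = UNIV" and z0: "z0 \<in> D"
    and willmore: "willmore_surface D y"
    and gauss_map: "conformal_gauss_map D y f"
    and symmetry: "orientation_reversing_symmetry D y \<mu> S"
    and Shat: "Shat \<in> Oplus" "induces Shat S"
    and frame: "gauss_frame D y f F0" "F0 z0 = mat 1"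
    and ext_frame: "extended_frame D z0 F0 F"
    and M: "M \<in> loop_group Oplus" "M 1 = Shat"
    and k: "\<And>z. z \<in> D \<Longrightarrow> k z \<in> O13_On"
    and Mk: "\<And>z l. z \<in> D \<Longrightarrow> l \<in> sphere 0 1 \<Longrightarrow> F (\<mu> z) l = M l ** F z (inverse l) ** k z"
    and birkhoff: "birkhoff_decomposition D X F Fm Fp"
  shows "let W = W_plus \<mu> k Fp;
             \<eta> = normalized_potential Fm;
             \<Omega> = {z \<in> D. z \<notin> X \<and> \<mu> z \<notin> X}
         in
         (\<forall>z\<in>\<Omega>. \<forall>l\<in>sphere 0 1.
            Fm (\<mu> z) l = cmat (M l) ** cnj_mat (Fm z (inverse l)) ** W z l) \<and>
         (\<forall>l\<in>sphere 0 1. mat_holomorphic_on (\<lambda>z. cnj_mat (W z l)) \<Omega>) \<and>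
         (\<forall>z\<in>\<Omega>. \<forall>l\<in>sphere 0 1. \<forall>v.
            pullback \<mu> (\<eta> l) z v = ((\<lambda>z v. cnj_mat (\<eta> (inverse l) z v)) \<sharp> (\<lambda>z. W z l)) z v) \<and>
         (det Shat = 1 \<longrightarrow> (\<forall>z\<in>\<Omega>. W z \<in> loop_plus SOplusC)) \<and>
         (det Shat = - 1 \<longrightarrow> (\<forall>z\<in>\<Omega>. (\<lambda>l. P2 ** W z l) \<in> loop_plus SOplusC))"
proof -
  let ?W = "W_plus \<mu> k Fp" and ?\<Omega> = "{z \<in> D. z \<notin> X \<and> \<mu> z \<notin> X}"
  let ?N = "\<lambda>z l. cnj_mat (Fm z (inverse l))"

  \<comment> \<open>Domains and regularity of the given maps\<close>
  have openD: "open D"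
    using D by auto
  have \<mu>D: "\<mu> z \<in> D" if "z \<in> D" for z
    using symmetry that
    by (auto simp: orientation_reversing_symmetry_def antiholomorphic_automorphism_def bij_betw_def)
  have \<mu>_hol: "(\<lambda>z. cnj (\<mu> z)) holomorphic_on D"
    using symmetry
    by (auto simp: orientation_reversing_symmetry_def antiholomorphic_automorphism_def)
  have \<mu>_cont: "continuous_on D \<mu>"
    using continuous_on_cnj[OF holomorphic_on_imp_continuous_on[OF \<mu>_hol]] by simp
  have openDX: "open (D - X)"
    using birkhoff openD open_diff_sparse unfolding birkhoff_decomposition_def by blast
  \<comment> \<open>As \<open>\<mu>\<close> maps \<open>D\<close> to itself,
    \<open>?\<Omega>\<close> is \<open>D - X\<close> cut with the preimage of an open set under a
    continuous map.\<close>
  have "?\<Omega> = (D - X) \<inter> {z \<in> D. \<mu> z \<in> D - X}"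
    using \<mu>D by blast
  then have open\<Omega>: "open ?\<Omega>"
    using open_vimage_Int[OF \<mu>_cont openD openDX] openDX by auto
  have FmFp: "cmat (F z l) = Fm z l ** Fp z l" if "z \<in> D - X" "l \<in> sphere 0 1" for z l
    using birkhoff that by (simp add: birkhoff_decomposition_def)
  have Fm_loop: "Fm z \<in> loop_group SOplusC" and Fp_loop: "Fp z \<in> loop_plus SOplusC"
    if "z \<in> D - X" for z
    using birkhoff that by (auto simp: birkhoff_decomposition_def loop_minus_star_def)
  have Fm_L: "Fm z l \<in> lorentz_group" and Fm_det: "det (Fm z l) = 1"
    and Fp_L: "Fp z l \<in> lorentz_group" and Fp_det: "det (Fp z l) = 1"
    if "z \<in> D - X" "l \<in> sphere 0 1" for z l
    using Fm_loop[OF that(1)] Fp_loop[OF that(1)] that(2)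
    by (auto simp: loop_plus_def loop_group_def SOplusC_eq)
  have Fm_hol: "mat_holomorphic_on (\<lambda>z. Fm z l) (D - X)" if "l \<in> sphere 0 1" for l
    using birkhoff that by (simp add: birkhoff_decomposition_def)
  have M_loop: "(\<lambda>l. cmat (M l)) \<in> loop_group lorentz_group"
    by (rule loop_group_cmat[OF M(1)])
  have inv_sphere: "inverse l \<in> sphere 0 1" if "l \<in> sphere 0 1" for l :: complex
    using that by (simp add: norm_inverse)

  \<comment> \<open>Transformation of the factor \<open>Fm\<close>\<close>
  have factor: "Fm (\<mu> z) l = cmat (M l) ** ?N z l ** ?W z l"
    if z: "z \<in> ?\<Omega>" and l: "l \<in> sphere 0 1" for z l
  proof -
    have z': "z \<in> D - X" and \<mu>z: "\<mu> z \<in> D - X"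
      using z \<mu>D by auto
    have real: "cmat (F z (inverse l)) = ?N z l ** cnj_mat (Fp z (inverse l))"
      using FmFp[OF z' inv_sphere[OF l]] by (metis cnj_mat_cmat cnj_mat_mult)
    have "Fm (\<mu> z) l ** Fp (\<mu> z) l
        = cmat (M l) ** ?N z l ** cnj_mat (Fp z (inverse l)) ** cmat (k z)"
      using FmFp[OF \<mu>z l] Mk[of z l] z' l real by (simp add: cmat_mult matrix_mul_assoc)
    then have "Fm (\<mu> z) l ** (Fp (\<mu> z) l ** lorentz_adj (Fp (\<mu> z) l))
        = cmat (M l) ** ?N z l ** ?W z l"
      by (simp add: W_plus_def matrix_inv_lorentz[OF Fp_L[OF \<mu>z l]] matrix_mul_assoc)
    then show ?thesis
      by (simp add: mult_lorentz_adj[OF Fp_L[OF \<mu>z l]])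
  qed

  \<comment> \<open>Twisting of \<open>?W\<close> and its antiholomorphy in \<open>z\<close>\<close>
  have N_loop: "?N z \<in> loop_group lorentz_group" if "z \<in> D - X" for z
    using Fm_loop[OF that] by (simp add: loop_group_SOplusC_iff loop_group_cnj_inverse)

  \<comment> \<open>Solving \<open>factor\<close> for \<open>?W\<close> removes \<open>Fp\<close>
    and \<open>k\<close>, of which no holomorphy in \<open>z\<close> is given.\<close>
  have W_eq: "?W z l = lorentz_adj (?N z l) ** lorentz_adj (cmat (M l)) ** Fm (\<mu> z) l"
    if z: "z \<in> ?\<Omega>" and l: "l \<in> sphere 0 1" for z l
  proof -
    have "?N z l \<in> lorentz_group" "cmat (M l) \<in> lorentz_group"
      using loop_group_memD[OF N_loop l] loop_group_memD[OF M_loop l] z by auto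
    then have "lorentz_adj (?N z l) ** (lorentz_adj (cmat (M l)) ** cmat (M l)) ** ?N z l = mat 1"
      by (simp add: lorentz_adj_mult)
    then show ?thesis
      using factor[OF z l] by (simp add: matrix_mul_assoc)
  qed

  have W_loop: "?W z \<in> loop_group lorentz_group" if z: "z \<in> ?\<Omega>" for z
  proof -
    have z': "z \<in> D - X" and \<mu>z: "\<mu> z \<in> D - X"
      using z \<mu>D by auto
    have "Fm (\<mu> z) \<in> loop_group lorentz_group"
      using Fm_loop[OF \<mu>z] by (simp only: loop_group_SOplusC_iff)
    then have "(\<lambda>l. lorentz_adj (?N z l) ** lorentz_adj (cmat (M l)) ** Fm (\<mu> z) l)
        \<in> loop_group lorentz_group"
      by (rule loop_group_mult[OF
            loop_group_mult[OF loop_group_adj[OF N_loop[OF z']] loop_group_adj[OF M_loop]]])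
    then show ?thesis
      by (subst loop_group_cong) (auto simp only: W_eq[OF z])
  qed

  \<comment> \<open>That \<open>?W\<close> depends on the conjugate variable alone is expressed by
    holomorphy of its entrywise conjugate.\<close>
  have W_hol: "mat_holomorphic_on (\<lambda>z. cnj_mat (?W z l)) ?\<Omega>" if l: "l \<in> sphere 0 1" for l
  proof -
    \<comment> \<open>The conjugate of \<open>Fm (\<mu> z) l\<close> is the reflection of
      \<open>Fm\<close> composed with the holomorphic map
      \<open>\<lambda>z. cnj (\<mu> z)\<close>.\<close>
    have "mat_holomorphic_on (\<lambda>z. cnj_mat (Fm (cnj z) l)) (cnj ` (D - X))"
      by (rule mat_holomorphic_on_cnj_cnj[OF Fm_hol[OF l] openDX])
    moreover have "(\<lambda>z. cnj (\<mu> z)) holomorphic_on ?\<Omega>"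
      using \<mu>_hol by (rule holomorphic_on_subset) auto
    moreover have "(\<lambda>z. cnj (\<mu> z)) ` ?\<Omega> \<subseteq> cnj ` (D - X)"
      using \<mu>D by auto
    ultimately have "mat_holomorphic_on (\<lambda>z. cnj_mat (Fm (cnj (cnj (\<mu> z))) l)) ?\<Omega>"
      by (rule mat_holomorphic_on_compose)
    moreover have "mat_holomorphic_on (\<lambda>z. Fm z (inverse l)) ?\<Omega>"
      using Fm_hol[OF inv_sphere[OF l]] by (rule mat_holomorphic_on_subset) auto
    ultimately have "mat_holomorphic_on (\<lambda>z. lorentz_adj (Fm z (inverse l)) **
        lorentz_adj (cmat (M l)) ** cnj_mat (Fm (\<mu> z) l)) ?\<Omega>"
      unfolding lorentz_adj_def
      by (intro mat_holomorphic_on_mult mat_holomorphic_on_transpose mat_holomorphic_on_const) auto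
    then show ?thesis
    proof (rule mat_holomorphic_on_transform)
      fix z assume "z \<in> ?\<Omega>"
      then show "lorentz_adj (Fm z (inverse l)) ** lorentz_adj (cmat (M l)) ** cnj_mat (Fm (\<mu> z) l)
          = cnj_mat (?W z l)"
        using W_eq[OF _ l] by (simp add: lorentz_adj_def cnj_mat_mult cnj_mat_transpose cnj_mat_Ilor)
    qed
  qed

  \<comment> \<open>Transformation of the normalized potential\<close>
  have potential: "pullback \<mu> (normalized_potential Fm l) z v
      = ((\<lambda>z v. cnj_mat (normalized_potential Fm (inverse l) z v)) \<sharp> (\<lambda>z. ?W z l)) z v"
    if z: "z \<in> ?\<Omega>" and l: "l \<in> sphere 0 1" for z l v
  proof -
    have z': "z \<in> D - X" and \<mu>z: "\<mu> z \<in> D - X"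
      using z \<mu>D by auto
    define dFm where "dFm = frechet_derivative (\<lambda>w. Fm w l) (at (\<mu> z))"
    define dFi where "dFi = frechet_derivative (\<lambda>w. Fm w (inverse l)) (at z)"
    define dW where "dW = frechet_derivative (\<lambda>w. ?W w l) (at z)"
    define d\<mu> where "d\<mu> = frechet_derivative \<mu> (at z)"
    \<comment> \<open>\<open>?W\<close> is antiholomorphic, but conjugation preserves real
      differentiability. This makes \<open>dW\<close> a genuine derivative.\<close>
    have "(\<lambda>w. cnj_mat (cnj_mat (?W w l))) differentiable (at z)"
      using mat_holomorphic_on_imp_differentiable[OF W_hol[OF l] open\<Omega> z]
      by (rule differentiable_bounded_linear[OF bounded_linear_cnj_mat])
    then have W': "((\<lambda>w. ?W w l) has_derivative dW) (at z)"
      unfolding dW_def by (simp add: frechet_derivative_works)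
    have Fm': "((\<lambda>w. Fm w l) has_derivative dFm) (at (\<mu> z))"
      unfolding dFm_def using mat_holomorphic_on_imp_differentiable[OF Fm_hol[OF l] openDX \<mu>z]
      by (simp add: frechet_derivative_works)
    have Fi': "((\<lambda>w. Fm w (inverse l)) has_derivative dFi) (at z)"
      unfolding dFi_def
      using mat_holomorphic_on_imp_differentiable[OF Fm_hol[OF inv_sphere[OF l]] openDX z']
      by (simp add: frechet_derivative_works)
    have "(\<lambda>w. cnj (\<mu> w)) differentiable (at z)"
      using \<mu>_hol openD z'
      by (auto intro: field_differentiable_imp_differentiable holomorphic_on_imp_differentiable_at)
    then have "(\<lambda>w. cnj (cnj (\<mu> w))) differentiable (at z)"
      by (rule differentiable_bounded_linear[OF bounded_linear_cnj])
    then have \<mu>': "(\<mu> has_derivative d\<mu>) (at z)"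
      unfolding d\<mu>_def by (simp add: frechet_derivative_works)
    have lhs: "((\<lambda>w. Fm (\<mu> w) l) has_derivative (\<lambda>v. dFm (d\<mu> v))) (at z)"
      using has_derivative_compose[OF \<mu>' Fm'] .
    have "((\<lambda>w. cmat (M l) ** ?N w l ** ?W w l) has_derivative
        (\<lambda>v. cmat (M l) ** ?N z l ** dW v + cmat (M l) ** cnj_mat (dFi v) ** ?W z l)) (at z)"
      by (intro bounded_bilinear.FDERIV[OF bounded_bilinear_matrix_mult, OF _ W']
          bounded_linear.has_derivative[OF
            bounded_bilinear.bounded_linear_right[OF bounded_bilinear_matrix_mult]]
          bounded_linear.has_derivative[OF bounded_linear_cnj_mat] Fi')
    \<comment> \<open>\<open>factor\<close> is known on \<open>?\<Omega>\<close> only; openness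
      makes the two functions agree near \<open>z\<close>.\<close>
    then have "((\<lambda>w. Fm (\<mu> w) l) has_derivative
        (\<lambda>v. cmat (M l) ** ?N z l ** dW v + cmat (M l) ** cnj_mat (dFi v) ** ?W z l)) (at z)"
      by (rule has_derivative_transform_within_open[OF _ open\<Omega> z]) (rule factor[OF _ l, symmetric])
    with lhs have d_eq:
      "dFm (d\<mu> v) = cmat (M l) ** ?N z l ** dW v + cmat (M l) ** cnj_mat (dFi v) ** ?W z l"
      by (metis (no_types, lifting) has_derivative_unique)
    have N_lor: "?N z l \<in> lorentz_group" and M_lor: "cmat (M l) \<in> lorentz_group"
      and W_lor: "?W z l \<in> lorentz_group"
      using loop_group_memD[OF N_loop[OF z'] l] loop_group_memD[OF M_loop l]
        loop_group_memD[OF W_loop[OF z] l] by auto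
    have inv_eq: "matrix_inv (Fm (\<mu> z) l)
        = lorentz_adj (?W z l) ** lorentz_adj (?N z l) ** lorentz_adj (cmat (M l))"
    proof (rule matrix_inv_eqI)
      have "lorentz_adj (?W z l) ** lorentz_adj (?N z l) ** lorentz_adj (cmat (M l)) ** Fm (\<mu> z) l
          = lorentz_adj (?W z l) ** (lorentz_adj (?N z l) ** (lorentz_adj (cmat (M l)) ** cmat (M l))
              ** ?N z l) ** ?W z l"
        by (simp add: factor[OF z l] matrix_mul_assoc)
      then show "lorentz_adj (?W z l) ** lorentz_adj (?N z l) ** lorentz_adj (cmat (M l))
          ** Fm (\<mu> z) l = mat 1"
        by (simp add: lorentz_adj_mult N_lor M_lor W_lor)
    qed
    \<comment> \<open>\<open>M l\<close> is constant in \<open>z\<close>: it contributes no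
      derivative and cancels. What remains is the logarithmic derivative of \<open>?W\<close>, plus
      that of \<open>?N\<close> conjugated by \<open>?W\<close>.\<close>
    have "matrix_inv (Fm (\<mu> z) l) ** dFm (d\<mu> v)
        = lorentz_adj (?W z l) ** (lorentz_adj (?N z l) ** (lorentz_adj (cmat (M l)) ** cmat (M l))
              ** ?N z l) ** dW v
          + lorentz_adj (?W z l) ** lorentz_adj (?N z l) ** (lorentz_adj (cmat (M l)) ** cmat (M l))
              ** cnj_mat (dFi v) ** ?W z l"
      by (simp only: inv_eq d_eq matrix_add_ldistrib matrix_mul_assoc)
    also have "\<dots> = lorentz_adj (?W z l) ** dW v
        + lorentz_adj (?W z l) ** (lorentz_adj (?N z l) ** cnj_mat (dFi v)) ** ?W z l"
      by (simp add: lorentz_adj_mult N_lor M_lor matrix_mul_assoc)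
    also have "lorentz_adj (?N z l) ** cnj_mat (dFi v)
        = cnj_mat (matrix_inv (Fm z (inverse l)) ** dFi v)"
      by (simp add: matrix_inv_lorentz[OF Fm_L[OF z' inv_sphere[OF l]]] lorentz_adj_def
          cnj_mat_mult cnj_mat_transpose cnj_mat_Ilor)
    finally show ?thesis
      by (simp add: pullback_def normalized_potential_def mc_form_def gauge_def
          matrix_inv_lorentz[OF W_lor] add.commute flip: dFm_def dFi_def dW_def d\<mu>_def)
  qed

  \<comment> \<open>Extension of \<open>?W\<close> to the disc, and its determinant\<close>
  have W_ext: "\<exists>g. extends_inside (?W z) g" if z: "z \<in> ?\<Omega>" for z
  proof -
    have z': "z \<in> D - X" and \<mu>z: "\<mu> z \<in> D - X"
      using z \<mu>D by auto
    obtain g h where "extends_inside (Fp z) g" "extends_inside (Fp (\<mu> z)) h"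
      using Fp_loop[OF z'] Fp_loop[OF \<mu>z] by (auto simp: loop_plus_def)
    \<comment> \<open>\<open>k z\<close> is independent of \<open>l\<close> and extends as a
      constant; the first factor extends by reflection.\<close>
    then have "extends_inside
        (\<lambda>l. cnj_mat (Fp z (inverse l)) ** cmat (k z) ** lorentz_adj (Fp (\<mu> z) l))
        (\<lambda>l. cnj_mat (g (cnj l)) ** cmat (k z) ** lorentz_adj (h l))"
      by (intro extends_inside_mult extends_inside_const extends_inside_cnj_inverse
          extends_inside_adj)
    then have "extends_inside (?W z) (\<lambda>l. cnj_mat (g (cnj l)) ** cmat (k z) ** lorentz_adj (h l))"
      by (rule extends_inside_cong) (simp add: W_plus_def matrix_inv_lorentz[OF Fp_L[OF \<mu>z]])
    then show ?thesis by blast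
  qed

  \<comment> \<open>The product form covers both signs: if \<open>det Shat\<close> is 1 or
    \<open>- 1\<close>, then \<open>det (?W z l)\<close> equals it.\<close>
  have W_det: "complex_of_real (det Shat) * det (?W z l) = 1"
    if z: "z \<in> ?\<Omega>" and l: "l \<in> sphere 0 1" for z l
  proof -
    have z': "z \<in> D - X" and \<mu>z: "\<mu> z \<in> D - X"
      using z \<mu>D by auto
    have F_det: "det (F w 1) = 1" if "w \<in> D - X" for w
    proof -
      have "complex_of_real (det (F w 1)) = det (Fm w 1) * det (Fp w 1)"
        using FmFp[OF that, of 1] by (simp flip: det_cmat det_mul)
      then show ?thesis
        using Fm_det[OF that, of 1] Fp_det[OF that, of 1] by simp
    qed
    \<comment> \<open>As \<open>k\<close> is independent of \<open>l\<close>, its determinant can be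
      computed at \<open>l = 1\<close>, where \<open>inverse l = l\<close> and \<open>M l\<close> is
      \<open>Shat\<close>.\<close>
    have "det (F (\<mu> z) 1) = det Shat * det (F z 1) * det (k z)"
      using Mk[of z 1] z' M(2) by (simp add: det_mul)
    then have k_det: "det Shat * det (k z) = 1"
      using F_det[OF z'] F_det[OF \<mu>z] by simp
    have "det (lorentz_adj (Fp (\<mu> z) l)) * det (Fp (\<mu> z) l) = 1"
      using lorentz_adj_mult[OF Fp_L[OF \<mu>z l]] by (metis det_I det_mul)
    then have "det (?W z l) = complex_of_real (det (k z))"
      using Fp_det[OF \<mu>z l] Fp_det[OF z' inv_sphere[OF l]]
      by (simp add: W_plus_def matrix_inv_lorentz[OF Fp_L[OF \<mu>z l]] det_mul det_cnj_mat det_cmat)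
    then show ?thesis
      using k_det by (metis of_real_1 of_real_mult)
  qed

  \<comment> \<open>The two cases of \<open>det Shat\<close>\<close>
  have "?W z \<in> loop_plus SOplusC" if "det Shat = 1" "z \<in> ?\<Omega>" for z
    using W_loop[OF that(2)] W_ext[OF that(2)] W_det[OF that(2)] that(1)
    by (auto simp: loop_plus_def loop_group_SOplusC_iff)
  moreover have "(\<lambda>l. P2 ** ?W z l) \<in> loop_plus SOplusC" if "det Shat = - 1" "z \<in> ?\<Omega>" for z
  proof -
    obtain g where "extends_inside (?W z) g"
      using W_ext[OF \<open>z \<in> ?\<Omega>\<close>] by blast
    \<comment> \<open>\<open>P2\<close> is constant in \<open>l\<close> and fixed by
      \<open>sigma\<close>, so it disturbs neither extension nor twisting, while its determinant
      \<open>- 1\<close> compensates that of \<open>?W\<close>.\<close>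
    then have "extends_inside (\<lambda>l. P2 ** ?W z l) (\<lambda>l. P2 ** g l)"
      by (intro extends_inside_mult extends_inside_const)
    moreover have "(\<lambda>l. P2 ** ?W z l) \<in> loop_group lorentz_group"
      by (intro loop_group_mult loop_group_const P2_lorentz sigma_P2 W_loop that(2))
    ultimately show ?thesis
      using W_det[OF that(2)] that(1)
      by (auto simp: loop_plus_def loop_group_SOplusC_iff det_mul det_P2)
  qed
  ultimately show ?thesis
    unfolding Let_def using factor W_hol potential by blast
qed

end
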